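(* Let $n \ge 1000$ be an integer divisible by $10$ and let $P = \overline{\mathcal{P}_{n/10,n}}$. If $C \in \mathbb{R}^n$ is a random direction uniformly distributed on the unit sphere of $\mathbb{R}^n$, then for every positive integer $k \le \frac{n}{10}$ we have $$\Pr\left( gap^k_P(C) \ge \frac{\sqrt{n}}{20} \right) \ge 1 - \frac{4}{n}.$$
   Context: For a real $t$ and a positive integer $n$, $\mathcal{P}_{t,n} = \{x \in [0,1]^n : \sum_{i=1}^n x_i \le t\}$. For $x \in \mathbb{R}^n$ and $I \subseteq [n] = \{1,\dots,n\}$, $x^I \in \mathbb{R}^n$ is the vector with $x^I_i = x_i$ if $i \in I$ and $x^I_i = -x_i$ if $i \notin I$; for $P \subseteq \mathbb{R}^n$, $P^I = \{x^I : x \in P\}$. For a polytope $P \subseteq \mathbb{R}^n_+$ its symmetrized version is $\overline{P} = \mathrm{conv}\left(\bigcup_{I \subseteq [n]} P^I\right)$. An inequality $\alpha x \le \beta$ (with $\alpha\in\mathbb{R}^n$, $\beta\in\mathbb{R}$, and $\alpha x$ denoting the inner product) is called $k$-sparse if $\alpha$ has at most $k$ non-zero components. It is valid for $P\subseteq\mathbb{R}^n$ if it is satisfied by all points of $P$. For a polytope $P \subset \mathbb{R}^n$ and a positive integer $k$, $P^k$ (integer superscript) denotes the set of points of $\mathbb{R}^n$ satisfying all $k$-sparse inequalities valid for $P$. For a polytope $P \subseteq \mathbb{R}^n$ and $c \in \mathbb{R}^n$, $gap^k_P(c) = \max_{x \in P^k} cx - \max_{x \in P} cx$, where $cx$ denotes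 the inner product. *)

theory Defs
  imports "HOL-Probability.Probability"
begin

text \<open>The space \<open>real ^ 'n\<close> plays the role of R^n, with \<open>n = CARD('n)\<close> and the index type \<open>'n\<close>
  in the role of \<open>[n]\<close>.\<close>

definition capped_cube :: "real \<Rightarrow> (real ^ 'n) set" where
  "capped_cube t = {x. (\<forall>i. 0 \<le> x $ i \<and> x $ i \<le> 1) \<and> (\<Sum>i\<in>UNIV. x $ i) \<le> t}"

definition flip :: "'n set \<Rightarrow> real ^ 'n \<Rightarrow> real ^ 'n" where
  "flip I x = (\<chi> i. if i \<in> I then x $ i else - (x $ i))"

definition symmetrized :: "(real ^ 'n) set \<Rightarrow> (real ^ 'n) set" where
  "symmetrized P = convex hull (\<Union>I\<in>UNIV. flip I ` P)"

definition sparse_ineq :: "nat \<Rightarrow> real ^ 'n \<Rightarrow> bool" where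
  "sparse_ineq k \<alpha> \<longleftrightarrow> card {i. \<alpha> $ i \<noteq> 0} \<le> k"

definition valid_ineq :: "(real ^ 'n) set \<Rightarrow> real ^ 'n \<Rightarrow> real \<Rightarrow> bool" where
  "valid_ineq P \<alpha> \<beta> \<longleftrightarrow> (\<forall>x\<in>P. \<alpha> \<bullet> x \<le> \<beta>)"

definition sparse_closure :: "nat \<Rightarrow> (real ^ 'n) set \<Rightarrow> (real ^ 'n) set" where
  "sparse_closure k P =
    {x. \<forall>\<alpha> \<beta>. sparse_ineq k \<alpha> \<longrightarrow> valid_ineq P \<alpha> \<beta> \<longrightarrow> \<alpha> \<bullet> x \<le> \<beta>}"

text \<open>Both suprema are attained maxima when \<open>P\<close> is a nonempty polytope and \<open>k \<ge> 1\<close>; see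
  \<open>max_attained\<close> and \<open>max_attained_closure\<close> below.\<close>

definition gap :: "(real ^ 'n) set \<Rightarrow> nat \<Rightarrow> real ^ 'n \<Rightarrow> real" where
  "gap P k c = (SUP x\<in>sparse_closure k P. c \<bullet> x) - (SUP x\<in>P. c \<bullet> x)"

text \<open>The uniform distribution on the unit sphere, i.e. the normalised surface measure, obtained as
  the law of the direction \<open>sgn x = x /\<^sub>R norm x\<close> of a uniformly distributed point \<open>x\<close> of the unit
  ball.\<close>

definition uniform_sphere :: "(real ^ 'n) measure" where
  "uniform_sphere = distr (uniform_measure lborel (ball 0 1)) borel sgn"

lemma norm_axis_abs: "norm (axis i (s::real) :: real ^ 'n) = \<bar>s\<bar>"
  by (simp add: norm_eq_sqrt_inner inner_axis')

lemma max_attained: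
  assumes "polytope P" "P \<noteq> {}"
  shows "\<exists>x\<in>P. c \<bullet> x = (SUP y\<in>P. c \<bullet> y)" "\<forall>x\<in>P. c \<bullet> x \<le> (SUP y\<in>P. c \<bullet> y)"
proof -
  have "compact P" using assms polytope_imp_compact by blast
  moreover have "continuous_on P ((\<bullet>) c)" by (intro continuous_intros)
  ultimately obtain x where x: "x \<in> P" "\<forall>y\<in>P. c \<bullet> y \<le> c \<bullet> x"
    using assms(2) continuous_attains_sup by blast
  have "(SUP y\<in>P. c \<bullet> y) = c \<bullet> x" by (rule cSup_eq_maximum) (use x in auto)
  then show "\<exists>x\<in>P. c \<bullet> x = (SUP y\<in>P. c \<bullet> y)" "\<forall>x\<in>P. c \<bullet> x \<le> (SUP y\<in>P. c \<bullet> y)"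
    using x by auto
qed

lemma subset_sparse_closure: "P \<subseteq> sparse_closure k P"
  by (auto simp: sparse_closure_def valid_ineq_def)

lemma compact_sparse_closure:
  fixes P :: "(real ^ 'n) set"
  assumes "bounded P" "k \<ge> 1"
  shows "compact (sparse_closure k P)"
proof -
  have "sparse_closure k P = (\<Inter>(\<alpha>,\<beta>)\<in>{(\<alpha>,\<beta>). sparse_ineq k \<alpha> \<and> valid_ineq P \<alpha> \<beta>}. {x. \<alpha> \<bullet> x \<le> \<beta>})"
    by (auto simp: sparse_closure_def)
  then have cl: "closed (sparse_closure k P)"
    by (auto intro!: closed_INT closed_halfspace_le)
  obtain B where B: "\<forall>x\<in>P. norm x \<le> B" using assms(1) bounded_iff by blast
  have "\<bar>x $ i\<bar> \<le> B" if x: "x \<in> sparse_closure k P" for x and i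
  proof -
    have *: "s * x $ i \<le> B" if s: "\<bar>s\<bar> = 1" for s :: real
    proof -
      have "{j. axis i s $ j \<noteq> 0} \<subseteq> {i}" by (auto simp: axis_def)
      then have "card {j. axis i s $ j \<noteq> 0} \<le> 1" using card_mono[of "{i}"] by fastforce
      then have "sparse_ineq k (axis i s)" using assms(2) by (simp add: sparse_ineq_def)
      moreover have "valid_ineq P (axis i s) B"
        unfolding valid_ineq_def
      proof
        fix y assume "y \<in> P"
        have "axis i s \<bullet> y \<le> norm (axis i s) * norm y" by (rule norm_cauchy_schwarz)
        then show "axis i s \<bullet> y \<le> B" using B \<open>y \<in> P\<close> s by (fastforce simp: norm_axis_abs)
      qed
      ultimately have "axis i s \<bullet> x \<le> B" using x by (auto simp: sparse_closure_def)
      then show ?thesis by (simp add: inner_axis')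
    qed
    show ?thesis using *[of 1] *[of "-1"] by simp
  qed
  then have "norm x \<le> (\<Sum>i\<in>(UNIV::'n set). B)" if "x \<in> sparse_closure k P" for x
    using that norm_le_l1_cart[of x] sum_mono[of UNIV "\<lambda>i. \<bar>x $ i\<bar>" "\<lambda>i. B"] by fastforce
  then have "bounded (sparse_closure k P)" unfolding bounded_iff by blast
  with cl show ?thesis by (simp add: compact_eq_bounded_closed)
qed

lemma max_attained_closure:
  assumes "polytope P" "P \<noteq> {}" "k \<ge> 1"
  shows "\<exists>x\<in>sparse_closure k P. c \<bullet> x = (SUP y\<in>sparse_closure k P. c \<bullet> y)"
    "\<forall>x\<in>sparse_closure k P. c \<bullet> x \<le> (SUP y\<in>sparse_closure k P. c \<bullet> y)"
proof -
  have "compact (sparse_closure k P)"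
    using assms compact_sparse_closure polytope_imp_bounded by blast
  moreover have "sparse_closure k P \<noteq> {}" using assms(2) subset_sparse_closure by fastforce
  moreover have "continuous_on (sparse_closure k P) ((\<bullet>) c)" by (intro continuous_intros)
  ultimately obtain x where x: "x \<in> sparse_closure k P" "\<forall>y\<in>sparse_closure k P. c \<bullet> y \<le> c \<bullet> x"
    using continuous_attains_sup by blast
  have "(SUP y\<in>sparse_closure k P. c \<bullet> y) = c \<bullet> x" by (rule cSup_eq_maximum) (use x in auto)
  then show "\<exists>x\<in>sparse_closure k P. c \<bullet> x = (SUP y\<in>sparse_closure k P. c \<bullet> y)"
    "\<forall>x\<in>sparse_closure k P. c \<bullet> x \<le> (SUP y\<in>sparse_closure k P. c \<bullet> y)"
    using x by auto
qed

lemma polytope_capped_cube: "polytope (capped_cube t :: (real ^ 'n) set)"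
proof -
  have "capped_cube t = cbox 0 1 \<inter> {x::real^'n. 1 \<bullet> x \<le> t}"
    by (auto simp: capped_cube_def mem_box_cart inner_vec_def)
  then show ?thesis
    by (simp add: polytope_Int_polyhedron polytope_interval polyhedron_halfspace_le)
qed

lemma linear_flip: "linear (flip I)"
  by (rule linearI) (auto simp: flip_def vec_eq_iff)

lemma polytope_symmetrized:
  fixes P :: "(real ^ 'n) set"
  assumes "polytope P"
  shows "polytope (symmetrized P)"
proof -
  obtain V where V: "finite V" "P = convex hull V" using assms by (auto simp: polytope_def)
  have "symmetrized P = convex hull (\<Union>I\<in>UNIV. flip I ` V)" (is "_ = convex hull ?W")
    unfolding symmetrized_def
  proof (rule antisym)
    have "flip I ` P \<subseteq> convex hull ?W" for I :: "'n set"
    proof -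
      have "flip I ` P = convex hull (flip I ` V)"
        using V(2) convex_hull_linear_image[OF linear_flip] by auto
      also have "\<dots> \<subseteq> convex hull ?W" by (intro hull_mono) auto
      finally show ?thesis .
    qed
    then show "convex hull (\<Union>I\<in>UNIV. flip I ` P) \<subseteq> convex hull ?W"
      by (intro hull_minimal) (auto simp: convex_convex_hull)
    show "convex hull ?W \<subseteq> convex hull (\<Union>I\<in>UNIV. flip I ` P)"
      using V(2) by (intro hull_mono) (auto intro: hull_inc)
  qed
  then show ?thesis using V(1) by (simp add: polytope_convex_hull)
qed

lemma sgn_borel_measurable [measurable]: "sgn \<in> borel_measurable (borel :: (real ^ 'n) measure)"
  unfolding sgn_div_norm[abs_def] by measurable

lemma emeasure_unit_ball:
  "emeasure lborel (ball (0::real^'n) 1) \<noteq> 0" "emeasure lborel (ball (0::real^'n) 1) \<noteq> \<infinity>"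
proof -
  show "emeasure lborel (ball (0::real^'n) 1) \<noteq> 0"
    using emeasure_lborel_cbox_eq open_not_negligible[of "ball (0::real^'n) 1"]
    by (auto simp: negligible_iff_null_sets null_sets_def)
  show "emeasure lborel (ball (0::real^'n) 1) \<noteq> \<infinity>"
    using emeasure_bounded_finite[of "ball (0::real^'n) 1"] by auto
qed

lemma prob_space_uniform_sphere: "prob_space (uniform_sphere :: (real ^ 'n) measure)"
  unfolding uniform_sphere_def
  by (intro prob_space.prob_space_distr prob_space_uniform_measure) (use emeasure_unit_ball in auto)

lemma AE_uniform_sphere: "AE x in (uniform_sphere :: (real ^ 'n) measure). x \<in> sphere 0 1"
proof -
  have "AE x in lborel. x \<noteq> (0::real^'n)" by (rule AE_lborel_singleton)
  then have "AE x in uniform_measure lborel (ball (0::real^'n) 1). sgn x \<in> sphere 0 1"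
    by (intro AE_uniform_measureI) (auto simp: norm_sgn)
  then show ?thesis unfolding uniform_sphere_def by (subst AE_distr_iff) auto
qed

lemma linear_image_measure_scale:
  fixes f :: "real ^ 'n \<Rightarrow> real ^ 'n"
  assumes "linear f"
  shows "\<exists>c. \<forall>S\<in>lmeasurable. f ` S \<in> lmeasurable \<and> measure lebesgue (f ` S) = c * measure lebesgue S"
proof (rule induct_linear_elementary[OF assms])
  fix f g :: "real ^ 'n \<Rightarrow> real ^ 'n"
  assume "\<exists>c. \<forall>S\<in>lmeasurable. f ` S \<in> lmeasurable \<and> measure lebesgue (f ` S) = c * measure lebesgue S"
    and "\<exists>c. \<forall>S\<in>lmeasurable. g ` S \<in> lmeasurable \<and> measure lebesgue (g ` S) = c * measure lebesgue S"
  then obtain c d where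
    "\<forall>S\<in>lmeasurable. f ` S \<in> lmeasurable \<and> measure lebesgue (f ` S) = c * measure lebesgue S"
    "\<forall>S\<in>lmeasurable. g ` S \<in> lmeasurable \<and> measure lebesgue (g ` S) = d * measure lebesgue S"
    by blast
  then show "\<exists>c. \<forall>S\<in>lmeasurable. (f \<circ> g) ` S \<in> lmeasurable
      \<and> measure lebesgue ((f \<circ> g) ` S) = c * measure lebesgue S"
    unfolding image_comp[symmetric] by (intro exI[of _ "c * d"]) simp
next
  fix f :: "real ^ 'n \<Rightarrow> real ^ 'n" and i
  assume "linear f" and 0: "\<And>x. f x $ i = 0"
  have "negligible (f ` S)" for S
    by (rule negligible_subset[OF negligible_standard_hyperplane_cart[of i]]) (use 0 in auto)
  then show "\<exists>c. \<forall>S\<in>lmeasurable. f ` S \<in> lmeasurable \<and> measure lebesgue (f ` S) = c * measure lebesgue S"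
    by (intro exI[of _ 0]) (simp add: negligible_iff_measure)
next
  fix m :: "'n \<Rightarrow> real"
  show "\<exists>c. \<forall>S\<in>lmeasurable. (\<lambda>x. \<chi> i. m i * x $ i) ` S \<in> lmeasurable
      \<and> measure lebesgue ((\<lambda>x. \<chi> i. m i * x $ i) ` S) = c * measure lebesgue S"
    using measurable_stretch[of _ m] measure_stretch[of _ m] by blast
next
  fix m n :: 'n
  let ?h = "\<lambda>x :: real ^ 'n. \<chi> i. x $ Transposition.transpose m n i"
  have lin: "linear ?h" by (rule linearI) (simp_all add: vec_eq_iff)
  have box: "measure lebesgue (?h ` cbox a b) = 1 * measure lebesgue (cbox a b)" for a b
  proof -
    have img: "?h ` cbox a b = cbox (?h a) (?h b)"
    proof (intro set_eqI iffI)
      fix y assume "y \<in> cbox (?h a) (?h b)"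
      then have "?h y \<in> cbox a b"
        by (auto simp: mem_box_cart) (metis transpose_involutory)+
      moreover have "?h (?h y) = y" by (simp add: vec_eq_iff)
      ultimately show "y \<in> ?h ` cbox a b" by (intro image_eqI[of y ?h "?h y"]) (simp_all del: vec_lambda_beta)
    qed (auto simp: mem_box_cart)
    have "(\<Prod>i\<in>UNIV. (?h b - ?h a) $ i) = (\<Prod>i\<in>UNIV. (b - a) $ i)"
      using prod.permute[OF permutes_swap_id, of m UNIV n "\<lambda>i. (b - a) $ i"] by (simp add: o_def)
    moreover have "cbox (?h a) (?h b) = {} \<longleftrightarrow> cbox a b = {}" using img by auto
    ultimately show ?thesis by (simp add: img content_cbox_if_cart)
  qed
  show "\<exists>c. \<forall>S\<in>lmeasurable. ?h ` S \<in> lmeasurable \<and> measure lebesgue (?h ` S) = c * measure lebesgue S"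
    proof (rule exI[of _ "1::real"], rule ballI)
    fix S :: "(real ^ 'n) set" assume "S \<in> lmeasurable"
    from measure_linear_sufficient[OF lin this box]
    show "?h ` S \<in> lmeasurable \<and> measure lebesgue (?h ` S) = 1 * measure lebesgue S" by (simp only: simp_thms)
  qed
next
  fix m n :: 'n assume mn: "m \<noteq> n"
  let ?h = "\<lambda>x :: real ^ 'n. \<chi> i. if i = m then x $ m + x $ n else x $ i"
  have lin: "linear ?h" by (rule linearI) (auto simp: vec_eq_iff algebra_simps)
  have box: "measure lebesgue (?h ` cbox a b) = 1 * measure lebesgue (cbox a b)" for a b
  proof (cases "cbox a b = {}")
    case False
    define v where "v = axis n (a $ n)"
    have tr: "cbox a b = (+) v ` cbox (a - v) (b - v)"
      by (simp add: cbox_translation[symmetric])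
    have "?h ` cbox a b = (+) (?h v) ` ?h ` cbox (a - v) (b - v)"
      unfolding tr image_image using linear_add[OF lin] by simp
    then have "measure lebesgue (?h ` cbox a b) = measure lebesgue (?h ` cbox (a - v) (b - v))"
      by (simp only: measure_translation)
    also have "\<dots> = measure lebesgue (cbox (a - v) (b - v))"
      by (rule measure_shear_interval) (use mn False tr in \<open>auto simp: v_def axis_def\<close>)
    also have "\<dots> = measure lebesgue (cbox a b)"
      unfolding tr by (simp only: measure_translation)
    finally show ?thesis by simp
  qed simp
  show "\<exists>c. \<forall>S\<in>lmeasurable. ?h ` S \<in> lmeasurable \<and> measure lebesgue (?h ` S) = c * measure lebesgue S"
    proof (rule exI[of _ "1::real"], rule ballI)
    fix S :: "(real ^ 'n) set" assume "S \<in> lmeasurable"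
    from measure_linear_sufficient[OF lin this box]
    show "?h ` S \<in> lmeasurable \<and> measure lebesgue (?h ` S) = 1 * measure lebesgue S" by (simp only: simp_thms)
  qed
qed

lemma orthogonal_image_measure:
  fixes f :: "real ^ 'n \<Rightarrow> real ^ 'n"
  assumes f: "orthogonal_transformation f" and S: "S \<in> lmeasurable"
  shows "measure lebesgue (f ` S) = measure lebesgue S"
proof -
  obtain c where c: "\<And>S. S \<in> lmeasurable \<Longrightarrow> measure lebesgue (f ` S) = c * measure lebesgue S"
    using linear_image_measure_scale orthogonal_transformation_linear[OF f] by meson
  have "f ` ball 0 1 = ball 0 1"
    using image_orthogonal_transformation_ball[OF f, of 0 1] orthogonal_transformation_linear[OF f]
    by (simp add: linear_0)
  then have "c * measure lebesgue (ball (0::real^'n) 1) = measure lebesgue (ball (0::real^'n) 1)"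
    using c[of "ball 0 1"] by simp
  moreover have "measure lebesgue (ball (0::real^'n) 1) > 0"
    using content_ball_pos[of 1 "0::real^'n"] by simp
  ultimately have "c = 1" by simp
  then show ?thesis using c[OF S] by simp
qed

lemma uniform_sphere_invariant:
  fixes f :: "real ^ 'n \<Rightarrow> real ^ 'n"
  assumes f: "orthogonal_transformation f"
  shows "distr uniform_sphere borel f = uniform_sphere"
proof (rule measure_eqI)
  show "sets (distr uniform_sphere borel f) = sets uniform_sphere"
    by (simp add: uniform_sphere_def)
  fix A assume "A \<in> sets (distr uniform_sphere borel f)"
  then have A [measurable]: "A \<in> sets borel" by simp
  have lin: "linear f" using f by (simp add: orthogonal_transformation_linear)
  have cont: "continuous_on UNIV f" using lin by (simp add: linear_continuous_on linear_conv_bounded_linear)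
  have f_meas [measurable]: "f \<in> borel_measurable borel"
    using cont by (rule borel_measurable_continuous_onI)
  have nf: "norm (f x) = norm x" for x using f by (rule orthogonal_transformation_norm)
  have sgnf: "sgn (f x) = f (sgn x)" for x
    using lin by (simp add: sgn_div_norm nf linear_cmul)
  let ?S = "ball 0 1 \<inter> sgn -` f -` A" and ?T = "ball 0 1 \<inter> sgn -` A"
  have meas: "?S \<in> sets borel" "?T \<in> sets borel"
  proof -
    have "(f \<circ> sgn) -` A \<inter> space borel \<in> sets borel" "sgn -` A \<inter> space borel \<in> sets (borel :: (real^'n) measure)"
      by (rule measurable_sets[OF _ A], measurable)+
    then show "?S \<in> sets borel" "?T \<in> sets borel" by (auto simp: vimage_comp)
  qed
  have S_lm: "?S \<in> lmeasurable"
    by (rule bounded_set_imp_lmeasurable) (use meas in \<open>auto intro: bounded_Int\<close>)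
  have T_lm: "?T \<in> lmeasurable"
    by (rule bounded_set_imp_lmeasurable) (use meas in \<open>auto intro: bounded_Int\<close>)
  have img: "f ` ?S = ?T"
  proof
    show "f ` ?S \<subseteq> ?T" by (auto simp: nf sgnf)
    show "?T \<subseteq> f ` ?S"
    proof
      fix y assume y: "y \<in> ?T"
      obtain x where x: "y = f x" using orthogonal_transformation_surj[OF f] by (meson surjD)
      show "y \<in> f ` ?S" using y unfolding x by (intro imageI) (auto simp: nf sgnf)
    qed
  qed
  have "measure lebesgue ?S = measure lebesgue ?T"
    using orthogonal_image_measure[OF f S_lm] img by simp
  then have "emeasure lebesgue ?S = emeasure lebesgue ?T"
    using S_lm T_lm by (simp add: emeasure_eq_measure2 fmeasurableD2)
  then have eq: "emeasure lborel ?S = emeasure lborel ?T" using meas by simp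
  have us: "emeasure (uniform_sphere :: (real ^ 'n) measure) B
      = emeasure lborel (ball 0 1 \<inter> sgn -` B) / emeasure lborel (ball (0::real^'n) 1)"
    if B: "B \<in> sets borel" for B
  proof -
    have "sgn -` B \<in> sets (borel :: (real^'n) measure)"
      using measurable_sets[OF sgn_borel_measurable B] by simp
    then show ?thesis using B unfolding uniform_sphere_def by (subst emeasure_distr) auto
  qed
  have "f -` A \<in> sets borel" using measurable_sets[OF f_meas A] by simp
  then show "emeasure (distr uniform_sphere borel f) A = emeasure uniform_sphere A"
    using eq us[of A] us[of "f -` A"] A
    by (subst emeasure_distr) (auto simp: uniform_sphere_def)
qed

end

theory Submission
  imports Defs
begin

text \<open>A \<open>k\<close>-sparse inequality with \<open>k \<le> n/10\<close> that is valid for \<open>P\<close> is already valid for the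
  whole cube \<open>[-1,1]^n\<close>, so the maximum over the sparse closure is at least the \<open>l1\<close>-norm of \<open>c\<close>.
  On the other hand \<open>P\<close> lies in the Euclidean ball of radius \<open>sqrt (n/10)\<close>. Hence a small gap forces
  a unit vector \<open>c\<close> to have \<open>l1\<close>-norm at most \<open>(1/20 + sqrt (1/10)) sqrt n \<le> 2/5 sqrt n\<close>, and the
  cone over such vectors meets the unit ball inside an \<open>l1\<close>-ball of that radius. Comparing
  \<open>(4/5 sqrt n)^n / n!\<close> with the volume of the unit ball shows that this is exponentially unlikely.\<close>

section \<open>Volume of the l1-ball compared with the Euclidean ball\<close>

lemma orthogonal_transformation_flip: "orthogonal_transformation (flip I)"
  unfolding orthogonal_transformation_def
  by (auto simp: linear_flip flip_def inner_vec_def intro!: sum.cong)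

lemma std_simplex_cart:
  "convex hull (insert 0 Basis) = {x :: real ^ 'n. (\<forall>i. 0 \<le> x $ i) \<and> (\<Sum>i\<in>UNIV. x $ i) \<le> 1}"
proof -
  have B: "Basis = range (\<lambda>i::'n. axis i (1::real))"
    by (auto simp: Basis_vec_def)
  have "inj (\<lambda>i::'n. axis i (1::real))"
    by (auto simp: inj_on_def axis_eq_axis)
  then have "(\<Sum>b\<in>Basis. x \<bullet> b) = (\<Sum>i\<in>UNIV. x $ i)" for x :: "real ^ 'n"
    unfolding B by (simp add: sum.reindex inner_axis)
  then show ?thesis
    using substd_simplex[of "Basis :: (real ^ 'n) set"] by (simp add: B inner_axis)
qed

text \<open>The orthants cut the l1-ball into \<open>2 ^ CARD('n)\<close> reflections of the
  standard simplex scaled by \<open>r\<close>, each of volume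
  \<open>r ^ CARD('n) / fact CARD('n)\<close>. An upper bound suffices, so subadditivity replaces
  any argument about overlaps.\<close>

lemma measure_l1_ball_le:
  assumes "r > 0"
  shows "measure lebesgue {x :: real ^ 'n. (\<Sum>i\<in>UNIV. \<bar>x $ i\<bar>) \<le> r} \<le> (2 * r) ^ CARD('n) / fact CARD('n)"
    (is "measure lebesgue ?B \<le> _")
proof -
  define T where "T = (convex hull (insert 0 Basis) :: (real ^ 'n) set)"
  define D where "D = (\<lambda>x. r *\<^sub>R x + 0) ` T"
  have "compact T"
    unfolding T_def by (intro compact_convex_hull finite_imp_compact) auto
  then have T: "T \<in> lmeasurable" and D: "D \<in> lmeasurable"
    unfolding D_def by (auto intro!: lmeasurable_compact compact_continuous_image continuous_intros)
  have "measure lebesgue T = 1 / fact CARD('n)"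
    unfolding T_def using content_std_simplex[where 'a = "real ^ 'n"] \<open>compact T\<close>
    by (simp add: T_def borel_compact)
  then have mD: "measure lebesgue D = r ^ CARD('n) / fact CARD('n)"
    unfolding D_def using measure_lebesgue_affine[of r "0 :: real ^ 'n" T] assms by simp
  have flips: "flip I ` D \<in> lmeasurable" for I
    using D linear_image_measure_scale[OF linear_flip] by blast
  have "?B \<subseteq> (\<Union>I\<in>UNIV. flip I ` D)"
  proof
    fix x assume x: "x \<in> ?B"
    \<comment> \<open>Reflecting \<open>x\<close> into the nonnegative orthant and rescaling gives a
      point of the simplex; the signs of \<open>x\<close> tell which reflection leads back.\<close>
    define y where "y = (\<chi> i. \<bar>x $ i\<bar> / r)"
    have "y \<in> T"
      using x assms by (simp add: T_def std_simplex_cart y_def divide_simps flip: sum_divide_distrib)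
    moreover have "x = flip {i. 0 \<le> x $ i} (r *\<^sub>R y + 0)"
      using assms by (simp add: vec_eq_iff flip_def y_def)
    ultimately show "x \<in> (\<Union>I\<in>UNIV. flip I ` D)"
      unfolding D_def by blast
  qed
  moreover have "closed ?B"
    by (intro closed_Collect_le continuous_intros)
  ultimately have "measure lebesgue ?B \<le> measure lebesgue (\<Union>I\<in>UNIV. flip I ` D)"
    by (intro measure_mono_fmeasurable fmeasurable.finite_UN) (use flips in auto)
  also have "\<dots> \<le> (\<Sum>I\<in>(UNIV :: 'n set set). measure lebesgue (flip I ` D))"
    by (intro measure_UNION_le) (use flips in auto)
  also have "\<dots> = 2 ^ CARD('n) * measure lebesgue D"
    using orthogonal_image_measure[OF orthogonal_transformation_flip D]
    by (simp add: card_Pow flip: Pow_UNIV)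
  finally show ?thesis
    by (simp add: mD power_mult_distrib)
qed

text \<open>Each of the factors m+1, ..., 2m of \<open>fact (2 * m)\<close> is at least m. This
  crude substitute for Stirling absorbs the power of \<open>sqrt n\<close> in the volume
  ratio.\<close>

lemma fact_double_ge: "real m ^ m * fact m \<le> fact (2 * m)"
proof -
  have "real m ^ m \<le> pochhammer (real m + 1) m"
    using prod_mono[of "{0..<m}" "\<lambda>_. real m" "\<lambda>i. real m + 1 + real i"]
    by (simp add: pochhammer_prod)
  moreover have "fact (2 * m) = fact m * pochhammer (real m + 1) m"
    using pochhammer_product'[of "1::real" m m] by (simp add: pochhammer_fact mult_2 add.commute)
  ultimately show ?thesis
    by (simp add: mult.commute)
qed

text \<open>For n = 2m the unit ball has volume pi^m / m!, while the left side is at most (32/25)^m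
  / m!. Since 32/25 < 3/2 < pi/2, the ratio is at most 2^(-m).\<close>

lemma l1_ball_volume_ratio:
  assumes "n > 0" "even n"
  shows "(2 * (2 / 5 * sqrt (real n))) ^ n / fact n \<le> 4 / real n * unit_ball_vol (real n)"
proof -
  obtain m where n: "n = 2 * m" using assms by auto
  then have m: "m > 0" using assms by simp
  have "(2 * (2 / 5 * sqrt (real n))) ^ n = ((2 * (2 / 5 * sqrt (real n)))\<^sup>2) ^ m"
    by (simp add: n power_mult)
  also have "(2 * (2 / 5 * sqrt (real n)))\<^sup>2 = 32 / 25 * real m"
    by (simp add: n power_mult_distrib power2_eq_square)
  finally have "(2 * (2 / 5 * sqrt (real n))) ^ n / fact n = (32 / 25) ^ m * real m ^ m / fact (2 * m)"
    unfolding power_mult_distrib[of "32 / 25"] by (simp only: n)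
  also have "\<dots> \<le> (32 / 25) ^ m * (1 / fact m)"
    using fact_double_ge[of m] by (simp add: divide_simps mult.commute mult_left_mono)
  also have "\<dots> \<le> (pi / 2) ^ m * (1 / fact m)"
    using pi_gt3 by (intro mult_right_mono power_mono) auto
  also have "\<dots> = 1 / 2 ^ m * unit_ball_vol (real n)"
    unfolding n unit_ball_vol_even by (simp add: power_divide)
  also have "\<dots> \<le> 4 / real n * unit_ball_vol (real n)"
  \<comment> \<open>The exponential bound is weakened to 4/n = 2/m.\<close>
  proof (intro mult_right_mono)
    have "real m \<le> 2 ^ m" by (simp add: less_imp_le)
    also have "\<dots> \<le> 2 * 2 ^ m" by simp
    finally show "1 / 2 ^ m \<le> 4 / real n" using m by (simp add: n divide_simps)
  qed simp
  finally show ?thesis .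
qed

section \<open>Lower bound on the gap\<close>

text \<open>Coordinates in [0,1] satisfy \<open>(x $ i)\<^sup>2 \<le> x $ i\<close>, so the squared
  norm is at most t. Flips are isometries and the ball is convex, so the bound survives
  symmetrization.\<close>

lemma symmetrized_capped_cube_subset_cball:
  "symmetrized (capped_cube t :: (real ^ 'n) set) \<subseteq> cball 0 (sqrt t)"
  unfolding symmetrized_def
proof (rule hull_minimal)
  have "norm x \<le> sqrt t" if x: "x \<in> capped_cube t" for x :: "real ^ 'n"
  proof -
    have "(\<Sum>i\<in>UNIV. (x $ i)\<^sup>2) \<le> (\<Sum>i\<in>UNIV. x $ i)"
      using x by (intro sum_mono) (auto simp: capped_cube_def power2_eq_square mult_left_le)
    also have "(\<Sum>i\<in>UNIV. (x $ i)\<^sup>2) = (norm x)\<^sup>2"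
      unfolding power2_norm_eq_inner by (simp add: inner_vec_def power2_eq_square)
    finally have "(norm x)\<^sup>2 \<le> t"
      using x by (simp add: capped_cube_def)
    then show ?thesis by (rule real_le_rsqrt)
  qed
  then show "(\<Union>I\<in>UNIV. flip I ` (capped_cube t :: (real ^ 'n) set)) \<subseteq> cball 0 (sqrt t)"
    by (auto simp: orthogonal_transformation_norm[OF orthogonal_transformation_flip])
qed simp

text \<open>The indicator \<open>z\<close> of the support of \<alpha> has at most k \<le> t ones, so
  it lies in the capped cube. Flipped to the signs of \<alpha>, it forces \<beta> to be at least the
  l1-norm of \<alpha>, which dominates \<open>\<alpha> \<bullet> y\<close> on the whole
  cube.\<close>

lemma cube_subset_sparse_closure:
  fixes y :: "real ^ 'n"
  assumes k: "real k \<le> t" and y: "\<And>i. \<bar>y $ i\<bar> \<le> 1"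
  shows "y \<in> sparse_closure k (symmetrized (capped_cube t))"
  unfolding sparse_closure_def
proof (safe)
  fix \<alpha> :: "real ^ 'n" and \<beta>
  assume sp: "sparse_ineq k \<alpha>" and valid: "valid_ineq (symmetrized (capped_cube t)) \<alpha> \<beta>"
  define z :: "real ^ 'n" where "z = (\<chi> i. if \<alpha> $ i \<noteq> 0 then 1 else 0)"
  define I where "I = {i. \<alpha> $ i \<ge> 0}"
  have "(\<Sum>i\<in>UNIV. z $ i) = real (card {i. \<alpha> $ i \<noteq> 0})"
    by (simp add: z_def sum.If_cases)
  then have "z \<in> capped_cube t"
    using sp k by (auto simp: capped_cube_def sparse_ineq_def z_def)
  then have "flip I z \<in> symmetrized (capped_cube t)"
    unfolding symmetrized_def by (intro hull_inc) auto
  then have "\<alpha> \<bullet> flip I z \<le> \<beta>"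
    using valid by (simp add: valid_ineq_def)
  moreover have "\<alpha> \<bullet> flip I z = (\<Sum>i\<in>UNIV. \<bar>\<alpha> $ i\<bar>)"
    by (auto simp: inner_vec_def z_def I_def flip_def intro!: sum.cong)
  moreover have "\<alpha> $ i * y $ i \<le> \<bar>\<alpha> $ i\<bar>" for i
    using mult_left_le[of "\<bar>y $ i\<bar>" "\<bar>\<alpha> $ i\<bar>"] y[of i] abs_ge_self[of "\<alpha> $ i * y $ i"]
    by (simp add: abs_mult)
  then have "\<alpha> \<bullet> y \<le> (\<Sum>i\<in>UNIV. \<bar>\<alpha> $ i\<bar>)"
    by (auto simp: inner_vec_def intro!: sum_mono)
  ultimately show "\<alpha> \<bullet> y \<le> \<beta>" by linarith
qed

lemma gap_ge:
  fixes c :: "real ^ 'n"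
  assumes k: "k \<ge> 1" "real k \<le> t"
  shows "(\<Sum>i\<in>UNIV. \<bar>c $ i\<bar>) - sqrt t * norm c \<le> gap (symmetrized (capped_cube t)) k c"
proof -
  let ?P = "symmetrized (capped_cube t) :: (real ^ 'n) set"
  \<comment> \<open>The sign vector maximizes c over the cube, with value the l1-norm of c.\<close>
  define s :: "real ^ 'n" where "s = (\<chi> i. sgn (c $ i))"
  have "0 \<in> (capped_cube t :: (real ^ 'n) set)"
    using k by (auto simp: capped_cube_def)
  then have "flip UNIV 0 \<in> ?P"
    unfolding symmetrized_def by (intro hull_inc) blast
  then have ne: "?P \<noteq> {}" by blast
  have "s \<in> sparse_closure k ?P"
    by (rule cube_subset_sparse_closure[OF k(2)]) (simp add: s_def abs_sgn_eq)
  then have "c \<bullet> s \<le> (SUP x\<in>sparse_closure k ?P. c \<bullet> x)"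
    using max_attained_closure(2)[OF polytope_symmetrized[OF polytope_capped_cube] ne k(1)] by blast
  moreover have "c \<bullet> s = (\<Sum>i\<in>UNIV. \<bar>c $ i\<bar>)"
    by (simp add: inner_vec_def s_def abs_sgn)
  moreover have "(SUP x\<in>?P. c \<bullet> x) \<le> sqrt t * norm c"
  proof (rule cSUP_least[OF ne])
    fix x assume "x \<in> ?P"
    then have "norm x \<le> sqrt t" using symmetrized_capped_cube_subset_cball mem_cball_0 by blast
    then show "c \<bullet> x \<le> sqrt t * norm c"
      using norm_cauchy_schwarz[of c x] mult_left_mono[of "norm x" "sqrt t" "norm c"]
      by (simp add: mult.commute)
  qed
  ultimately show ?thesis unfolding gap_def by linarith
qed

section \<open>Measurability of the gap and the probability bound\<close>

text \<open>Replacing d by c changes each inner product by at most \<open>norm (c - d) * B\<close>,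
  hence also the supremum: the function is B-Lipschitz. This yields measurability of the gap, whose
  suprema range over possibly uncountable sets.\<close>

lemma continuous_support_function:
  fixes S :: "'a :: real_inner set"
  assumes "bounded S" "S \<noteq> {}"
  shows "continuous_on UNIV (\<lambda>c. SUP x\<in>S. c \<bullet> x)"
proof -
  obtain B where B: "B > 0" "\<And>x. x \<in> S \<Longrightarrow> norm x \<le> B"
    using assms(1) bounded_pos by blast
  have le: "c \<bullet> x \<le> norm c * B" if "x \<in> S" for c x
    using norm_cauchy_schwarz[of c x] mult_left_mono[OF B(2)[OF that], of "norm c"] by simp
  have bdd: "bdd_above ((\<bullet>) c ` S)" for c
    using le by (intro bdd_aboveI2) auto
  have step: "(SUP x\<in>S. c \<bullet> x) \<le> (SUP x\<in>S. d \<bullet> x) + norm (c - d) * B" for c d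
  proof (rule cSUP_least[OF assms(2)])
    fix x assume x: "x \<in> S"
    have "c \<bullet> x = d \<bullet> x + (c - d) \<bullet> x" by (simp add: inner_diff_left)
    then show "c \<bullet> x \<le> (SUP x\<in>S. d \<bullet> x) + norm (c - d) * B"
      using le[OF x, of "c - d"] cSUP_upper[OF x bdd[of d]] by linarith
  qed
  have "B-lipschitz_on UNIV (\<lambda>c. SUP x\<in>S. c \<bullet> x)"
  proof (rule lipschitz_onI)
    show "dist (SUP x\<in>S. c \<bullet> x) (SUP x\<in>S. d \<bullet> x) \<le> B * dist c d" for c d
      using step[of c d] step[of d c]
      by (simp add: dist_real_def dist_norm norm_minus_commute mult.commute abs_le_iff)
  qed (use B in simp)
  then show ?thesis by (rule lipschitz_on_continuous_on)
qed

lemma borel_measurable_gap: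
  fixes P :: "(real ^ 'n) set"
  assumes "bounded P" "P \<noteq> {}" "k \<ge> 1"
  shows "gap P k \<in> borel_measurable borel"
proof -
  have "bounded (sparse_closure k P)"
    using compact_sparse_closure assms by (blast intro: compact_imp_bounded)
  moreover have "sparse_closure k P \<noteq> {}"
    using assms subset_sparse_closure by blast
  ultimately have "continuous_on UNIV (\<lambda>c. gap P k c)"
    unfolding gap_def using assms by (intro continuous_intros continuous_support_function)
  then show ?thesis by (rule borel_measurable_continuous_onI)
qed

lemma measure_uniform_sphere:
  fixes A :: "(real ^ 'n) set"
  assumes "A \<in> sets borel"
  shows "measure uniform_sphere A
    = measure lborel (ball 0 1 \<inter> sgn -` A) / unit_ball_vol (real CARD('n))"
proof -
  have "sgn -` A \<in> sets borel"
    using measurable_sets[OF sgn_borel_measurable assms] by simp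
  then show ?thesis
    using emeasure_unit_ball[where 'n = 'n] content_ball[of 1 "0 :: real ^ 'n"] assms
    unfolding uniform_sphere_def by (subst measure_distr) auto
qed

theorem theorem8:
  fixes M :: "'a measure" and C :: "'a \<Rightarrow> real ^ 'n" and P :: "(real ^ 'n) set" and k :: nat
  assumes n_ge: "CARD('n) \<ge> 1000" and n_dvd: "10 dvd CARD('n)"
    and P_eq: "P = symmetrized (capped_cube (real CARD('n) / 10))"
    and M: "prob_space M" and C: "C \<in> borel_measurable M"
    and C_unif: "distr M borel C = uniform_sphere"
    and k_pos: "k > 0" and k_le: "real k \<le> real CARD('n) / 10"
  shows "measure M {\<omega> \<in> space M. gap P k (C \<omega>) \<ge> sqrt (real CARD('n)) / 20}
    \<ge> 1 - 4 / real CARD('n)"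
proof -
  interpret prob_space M by (rule M)
  define n where "n = CARD('n)"
  have n: "n > 0" "even n"
    using n_ge n_dvd by (auto simp: n_def)
  define r where "r = 2 / 5 * sqrt (real n)"
  have r: "r > 0" using n by (simp add: r_def)
  define A where "A = {c. gap P k c < sqrt (real n) / 20}"
  define L where "L = {x :: real ^ 'n. (\<Sum>i\<in>UNIV. \<bar>x $ i\<bar>) \<le> r}"
  have P: "bounded P" "P \<noteq> {}"
  proof -
    show "bounded P"
      unfolding P_eq by (intro polytope_imp_bounded polytope_symmetrized polytope_capped_cube)
    have "0 \<in> (capped_cube (real CARD('n) / 10) :: (real ^ 'n) set)"
      by (auto simp: capped_cube_def)
    then show "P \<noteq> {}"
      unfolding P_eq symmetrized_def by auto
  qed
  have gap_meas [measurable]: "gap P k \<in> borel_measurable borel"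
    by (rule borel_measurable_gap) (use P k_pos in auto)
  have A [measurable]: "A \<in> sets borel"
    unfolding A_def by measurable
  have sub: "ball 0 1 \<inter> sgn -` A \<subseteq> L"
  proof
    fix x assume x: "x \<in> ball 0 1 \<inter> sgn -` A"
    show "x \<in> L"
    \<comment> \<open>The origin is treated apart because \<open>sgn 0 = 0\<close> is not a unit
      vector.\<close>
    proof (cases "x = 0")
      case False
      have "(\<Sum>i\<in>UNIV. \<bar>sgn x $ i\<bar>) - sqrt (real n / 10) * norm (sgn x) \<le> gap P k (sgn x)"
        unfolding P_eq n_def by (rule gap_ge) (use k_pos k_le in auto)
      also have "\<dots> < sqrt (real n) / 20"
        using x by (simp add: A_def)
      finally have "(\<Sum>i\<in>UNIV. \<bar>sgn x $ i\<bar>) < sqrt (real n / 10) + sqrt (real n) / 20"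
        using False by (simp add: norm_sgn)
      \<comment> \<open>1/10 \<le> 49/400 = (7/20)^2, and 7/20 + 1/20 = 2/5 is the factor in
        \<open>r\<close>.\<close>
      also have "sqrt (real n / 10) \<le> sqrt ((7 / 20)\<^sup>2 * real n)"
        by (simp add: power2_eq_square)
      also have "\<dots> = 7 / 20 * sqrt (real n)"
        by (simp add: real_sqrt_mult)
      finally have l1: "(\<Sum>i\<in>UNIV. \<bar>sgn x $ i\<bar>) < r"
        by (simp add: r_def)
      have "(\<Sum>i\<in>UNIV. \<bar>x $ i\<bar>) = norm x * (\<Sum>i\<in>UNIV. \<bar>sgn x $ i\<bar>)"
        using False by (simp add: sgn_div_norm abs_mult sum_distrib_left flip: mult.assoc)
      \<comment> \<open>As \<open>norm x < 1\<close>, the l1-bound for the direction passes to the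
        point itself.\<close>
      also have "\<dots> \<le> 1 * r"
        using x l1 r by (intro mult_mono) auto
      finally show ?thesis by (simp add: L_def)
    qed (use r in \<open>simp add: L_def\<close>)
  qed
  have L: "L \<in> sets borel"
    unfolding L_def by (intro borel_closed closed_Collect_le continuous_intros)
  moreover have "L \<subseteq> cball 0 r"
    unfolding L_def by (auto intro: order_trans[OF norm_le_l1_cart])
  ultimately have "L \<in> fmeasurable lborel"
    using emeasure_bounded_finite[OF bounded_subset[OF bounded_cball]] by (intro fmeasurableI) auto
  moreover have "sgn -` A \<in> sets borel"
    using measurable_sets[OF sgn_borel_measurable A] by simp
  ultimately have "measure lborel (ball 0 1 \<inter> sgn -` A) \<le> measure lborel L"
    using sub by (intro measure_mono_fmeasurable) auto
  also have "\<dots> \<le> (2 * r) ^ n / fact n"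
    using measure_l1_ball_le[OF r, where 'n = 'n] L by (simp add: L_def n_def)
  also have "\<dots> \<le> 4 / real n * unit_ball_vol (real n)"
    unfolding r_def using n by (rule l1_ball_volume_ratio)
  finally have "measure uniform_sphere A \<le> 4 / real n"
    using n by (simp add: measure_uniform_sphere[OF A] n_def[symmetric] pos_divide_le_eq)
  then have "prob {\<omega> \<in> space M. gap P k (C \<omega>) < sqrt (real n) / 20} \<le> 4 / real n"
    unfolding C_unif[symmetric] using C
    by (simp add: measure_distr A_def vimage_def Int_def conj_commute)
  moreover have "{\<omega> \<in> space M. gap P k (C \<omega>) \<ge> sqrt (real n) / 20}
      = space M - {\<omega> \<in> space M. gap P k (C \<omega>) < sqrt (real n) / 20}"
    by auto
  moreover have "{\<omega> \<in> space M. gap P k (C \<omega>) < sqrt (real n) / 20} \<in> events"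
    using C by measurable
  ultimately show ?thesis
    using prob_compl by (simp add: n_def)
qed

end
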